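(* There is no contravariant functor from the category $\mathbf{Ring}$ of rings to the category of sets that assigns to each ring $R$ the set of all maximal elements of $\operatorname{Hom}(R)$.
   Context: All rings are associative with identity $1\neq 0$ and ring morphisms send $1$ to $1$; $\mathbf{Ring}$ is the category of all such rings. $U(S)$ denotes the group of two-sided invertible elements of a ring $S$. For a ring $R$, $\operatorname{Hom}(R)$ denotes the set of all pairs $(\ker(\varphi),\varphi^{-1}(U(S)))$ where $\varphi\colon R\to S$ is a ring morphism into an arbitrary ring $S$, partially ordered by $(\mathfrak a,M)\le(\mathfrak b,N)$ if and only if $\mathfrak a\subseteq\mathfrak b$ and $M\subseteq N$. Maximal elements are taken with respect to this partial order. *)

theory Defs
  imports "HOL-Algebra.Algebra"
begin

text \<open>
  HOL has no type of all rings.  The category of rings is therefore taken relative to an infinite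
  type \<open>'u\<close>, playing the role of the universe: its objects are the rings whose carrier is a subset of
  \<open>'u\<close>, and all the functor data live on these objects.  The codomains of the morphisms that enter
  \<open>Hom_pairs\<close> are objects of the same category; lemma \<open>Hom_pairs_arbitrary_codomain\<close> below shows that
  codomains on any other type give no further pairs.
\<close>

definition nonzero_ring :: "('a, 'm) ring_scheme \<Rightarrow> bool" where
  "nonzero_ring R \<longleftrightarrow> ring R \<and> \<one>\<^bsub>R\<^esub> \<noteq> \<zero>\<^bsub>R\<^esub>"

text \<open>Elements of \<^const>\<open>ring_hom\<close> are total functions with irrelevant values outside the carrier;
  extensionality makes equality of morphisms coincide with equality of HOL functions.\<close>

definition ring_mor :: "'u ring \<Rightarrow> 'u ring \<Rightarrow> ('u \<Rightarrow> 'u) set" where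
  "ring_mor R S = ring_hom R S \<inter> extensional (carrier R)"

definition hom_pair ::
  "('a, 'm) ring_scheme \<Rightarrow> ('b, 'n) ring_scheme \<Rightarrow> ('a \<Rightarrow> 'b) \<Rightarrow> 'a set \<times> 'a set" where
  "hom_pair R S \<phi> = (a_kernel R S \<phi>, \<phi> -` Units S \<inter> carrier R)"

definition Hom_pairs :: "'u ring \<Rightarrow> ('u set \<times> 'u set) set" where
  "Hom_pairs R = {hom_pair R S \<phi> | (S :: 'u ring) \<phi>. nonzero_ring S \<and> \<phi> \<in> ring_mor R S}"

definition pair_le :: "'u set \<times> 'u set \<Rightarrow> 'u set \<times> 'u set \<Rightarrow> bool" where
  "pair_le p q \<longleftrightarrow> fst p \<subseteq> fst q \<and> snd p \<subseteq> snd q"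

definition Max_Hom :: "'u ring \<Rightarrow> ('u set \<times> 'u set) set" where
  "Max_Hom R = {p \<in> Hom_pairs R. \<forall>q \<in> Hom_pairs R. pair_le p q \<longrightarrow> q = p}"

text \<open>Contravariant functors from rings to sets: \<open>Fo\<close> is the action on objects, and \<open>Fm R S f\<close> is the
  map \<open>Fo S \<rightarrow> Fo R\<close> induced by \<open>f : R \<rightarrow> S\<close>.  Maps of sets are extensional functions as well.\<close>

definition contravariant_functor ::
  "('u ring \<Rightarrow> 'x set) \<Rightarrow> ('u ring \<Rightarrow> 'u ring \<Rightarrow> ('u \<Rightarrow> 'u) \<Rightarrow> 'x \<Rightarrow> 'x) \<Rightarrow> bool" where
  "contravariant_functor Fo Fm \<longleftrightarrow>
     (\<forall>R S f. nonzero_ring R \<longrightarrow> nonzero_ring S \<longrightarrow> f \<in> ring_mor R S \<longrightarrow>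
        Fm R S f \<in> Fo S \<rightarrow>\<^sub>E Fo R) \<and>
     (\<forall>R. nonzero_ring R \<longrightarrow>
        Fm R R (\<lambda>x\<in>carrier R. x) = (\<lambda>p\<in>Fo R. p)) \<and>
     (\<forall>R S T f g. nonzero_ring R \<longrightarrow> nonzero_ring S \<longrightarrow> nonzero_ring T \<longrightarrow>
        f \<in> ring_mor R S \<longrightarrow> g \<in> ring_mor S T \<longrightarrow>
        Fm R T (compose (carrier R) g f) = compose (Fo T) (Fm R S f) (Fm S T g))"

lemma card_of_generate_ring:
  fixes S :: "('v, 'm) ring_scheme"
  assumes inf: "infinite (UNIV :: 'u set)" and H: "|H| \<le>o |UNIV :: 'u set|"
  shows "|generate_ring S H| \<le>o |UNIV :: 'u set|"
proof -
  let ?U = "UNIV :: 'u set"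
  have Un: "|A \<union> B| \<le>o |?U|" if "|A| \<le>o |?U|" "|B| \<le>o |?U|" for A B :: "'v set"
    using card_of_Un_ordLeq_infinite[OF inf that] .
  have Im: "|f ` A| \<le>o |?U|" if "|A| \<le>o |?U|" for A :: "'w set" and f :: "'w \<Rightarrow> 'v"
    using ordLeq_transitive[OF card_of_image that] .
  have Ti: "|A \<times> A| \<le>o |?U|" if "|A| \<le>o |?U|" for A :: "'v set"
    using card_of_Times_ordLeq_infinite_Field[of "|?U|" A A] inf that by simp
  define step where "step A = A \<union> a_inv S ` A \<union> (\<lambda>(a, b). a \<oplus>\<^bsub>S\<^esub> b) ` (A \<times> A)
    \<union> (\<lambda>(a, b). a \<otimes>\<^bsub>S\<^esub> b) ` (A \<times> A)" for A
  define G where "G n = (step ^^ n) (H \<union> {\<one>\<^bsub>S\<^esub>})" for n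
  have G_Suc: "G (Suc n) = step (G n)" for n by (simp add: G_def)
  have one: "|{\<one>\<^bsub>S\<^esub>}| \<le>o |?U|"
    using card_of_singl_ordLeq[of ?U] by simp
  have "|G n| \<le>o |?U|" for n
  proof (induction n)
    case 0
    show ?case using Un[OF H one] by (simp add: G_def)
  next
    case (Suc n)
    show ?case unfolding G_Suc step_def
      by (intro Un Im Ti Suc)
  qed
  moreover have "|UNIV :: nat set| \<le>o |?U|"
    using inf infinite_iff_card_of_nat by blast
  ultimately have card: "|\<Union>n. G n| \<le>o |?U|"
    using card_of_UNION_ordLeq_infinite[OF inf] by blast
  have "mono G"
    unfolding mono_iff_le_Suc G_Suc by (auto simp: step_def)
  then have G_le: "G m \<subseteq> G n" if "m \<le> n" for m n
    using that by (rule monoD)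
  have "x \<in> (\<Union>n. G n)" if "x \<in> generate_ring S H" for x
    using that
  proof induction
    case one
    have "\<one>\<^bsub>S\<^esub> \<in> G 0" by (simp add: G_def)
    then show ?case by blast
  next
    case (incl h)
    then have "h \<in> G 0" by (simp add: G_def)
    then show ?case by blast
  next
    case (a_inv h)
    then obtain n where "h \<in> G n" by blast
    then have "\<ominus>\<^bsub>S\<^esub> h \<in> G (Suc n)" by (auto simp: G_Suc step_def)
    then show ?case by blast
  next
    case (eng_add a b)
    then obtain m n where "a \<in> G m" "b \<in> G n" by blast
    then have "a \<in> G (max m n)" "b \<in> G (max m n)"
      using G_le[of m "max m n"] G_le[of n "max m n"] by auto
    then have "a \<oplus>\<^bsub>S\<^esub> b \<in> G (Suc (max m n))" by (force simp: G_Suc step_def)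
    then show ?case by blast
  next
    case (eng_mult a b)
    then obtain m n where "a \<in> G m" "b \<in> G n" by blast
    then have "a \<in> G (max m n)" "b \<in> G (max m n)"
      using G_le[of m "max m n"] G_le[of n "max m n"] by auto
    then have "a \<otimes>\<^bsub>S\<^esub> b \<in> G (Suc (max m n))" by (force simp: G_Suc step_def)
    then show ?case by blast
  qed
  then have "generate_ring S H \<subseteq> (\<Union>n. G n)" by blast
  from ordLeq_transitive[OF card_of_mono1[OF this] card] show ?thesis .
qed

lemma Hom_pairs_arbitrary_codomain:
  fixes R :: "'u ring" and S :: "('v, 'm) ring_scheme"
  assumes inf: "infinite (UNIV :: 'u set)"
    and R: "nonzero_ring R" and S: "nonzero_ring S" and \<phi>: "\<phi> \<in> ring_hom R S"
  shows "hom_pair R S \<phi> \<in> Hom_pairs R"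
proof -
  let ?U = "UNIV :: 'u set"
  interpret S: ring S using S by (simp add: nonzero_ring_def)
  interpret R: ring R using R by (simp add: nonzero_ring_def)
  interpret \<phi>: ring_hom_ring R S \<phi>
    by (rule ring_hom_ringI2[OF R.ring_axioms S.ring_axioms \<phi>])
  let ?V = "\<phi> -` Units S \<inter> carrier R"
  define H where "H = \<phi> ` carrier R \<union> (\<lambda>r. inv\<^bsub>S\<^esub> (\<phi> r)) ` ?V"
  define K where "K = generate_ring S H"
  define S' where "S' = S\<lparr>carrier := K\<rparr>"
  have H_carr: "H \<subseteq> carrier S" by (auto simp: H_def)
  have sub: "subring K S" unfolding K_def by (rule S.generate_ring_is_subring[OF H_carr])
  have K_carr: "K \<subseteq> carrier S" using subringE(1)[OF sub] .
  have H_K: "H \<subseteq> K" by (auto simp: K_def generate_ring.incl)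
  interpret S': ring S' unfolding S'_def by (rule S.subring_is_ring[OF sub])
  have "|\<phi> ` carrier R| \<le>o |?U|" "|(\<lambda>r. inv\<^bsub>S\<^esub> (\<phi> r)) ` ?V| \<le>o |?U|"
    by (rule ordLeq_transitive[OF card_of_image card_of_mono1], simp)+
  then have "|H| \<le>o |?U|"
    unfolding H_def by (rule card_of_Un_ordLeq_infinite[OF inf])
  then have "|K| \<le>o |?U|"
    unfolding K_def by (rule card_of_generate_ring[OF inf])
  then obtain j :: "'v \<Rightarrow> 'u" where j: "inj_on j K"
    using card_of_ordLeq[of K ?U] by blast
  have j': "inj_on j (carrier S')" using j by (simp add: S'_def)
  define T where "T = image_ring j S'"
  have j_iso: "j \<in> ring_iso S' T"
    unfolding T_def by (rule inj_imp_image_ring_iso[OF j'])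
  have T_ring: "ring T"
    unfolding T_def by (rule S'.inj_imp_image_ring_is_ring[OF j'])
  interpret T: ring T by (rule T_ring)
  have carr_T: "carrier T = j ` K" and one_T: "\<one>\<^bsub>T\<^esub> = j \<one>\<^bsub>S\<^esub>" and zero_T: "\<zero>\<^bsub>T\<^esub> = j \<zero>\<^bsub>S\<^esub>"
    by (simp_all add: T_def S'_def image_ring_carrier image_ring_one image_ring_zero)
  have one_K: "\<one>\<^bsub>S\<^esub> \<in> K" and zero_K: "\<zero>\<^bsub>S\<^esub> \<in> K"
    using S'.one_closed S'.zero_closed by (simp_all add: S'_def)
  have T: "nonzero_ring T"
    using T_ring S j one_K zero_K
    by (auto simp: nonzero_ring_def one_T zero_T inj_on_def)
  have mult_K: "x \<otimes>\<^bsub>S\<^esub> y \<in> K" if "x \<in> K" "y \<in> K" for x y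
    using S'.m_closed[of x y] that by (simp add: S'_def)
  have mult_T: "j x \<otimes>\<^bsub>T\<^esub> j y = j (x \<otimes>\<^bsub>S\<^esub> y)" if "x \<in> K" "y \<in> K" for x y
    using j_iso that by (simp add: ring_iso_def ring_hom_def S'_def)
  have \<phi>_K: "\<phi> r \<in> K" if "r \<in> carrier R" for r
    using that H_K by (auto simp: H_def)
  define \<psi> where "\<psi> = (\<lambda>r\<in>carrier R. j (\<phi> r))"
  have "\<phi> \<in> ring_hom R S'"
    using \<phi> \<phi>_K by (auto simp: ring_hom_def S'_def)
  then have "j \<circ> \<phi> \<in> ring_hom R T"
    using j_iso by (auto intro: ring_hom_trans simp: ring_iso_def)
  then have \<psi>: "\<psi> \<in> ring_mor R T"
    by (auto simp: ring_mor_def \<psi>_def ring_hom_def Pi_iff)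
  have "\<psi> r = \<zero>\<^bsub>T\<^esub> \<longleftrightarrow> \<phi> r = \<zero>\<^bsub>S\<^esub>" if "r \<in> carrier R" for r
    using that inj_on_eq_iff[OF j \<phi>_K zero_K] by (simp add: \<psi>_def zero_T)
  then have "a_kernel R T \<psi> = a_kernel R S \<phi>"
    unfolding a_kernel_def' by blast
  moreover have "\<psi> r \<in> Units T \<longleftrightarrow> \<phi> r \<in> Units S" if r: "r \<in> carrier R" for r
  proof
    assume "\<psi> r \<in> Units T"
    then obtain y where y: "y \<in> K" "j y \<otimes>\<^bsub>T\<^esub> j (\<phi> r) = \<one>\<^bsub>T\<^esub>" "j (\<phi> r) \<otimes>\<^bsub>T\<^esub> j y = \<one>\<^bsub>T\<^esub>"
      using r by (auto simp: Units_def carr_T \<psi>_def)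
    then have "y \<otimes>\<^bsub>S\<^esub> \<phi> r = \<one>\<^bsub>S\<^esub>" "\<phi> r \<otimes>\<^bsub>S\<^esub> y = \<one>\<^bsub>S\<^esub>"
      using \<phi>_K[OF r] j one_K mult_K by (simp_all add: mult_T one_T inj_on_eq_iff)
    then show "\<phi> r \<in> Units S"
      using y(1) K_carr r by (auto simp: Units_def)
  next
    assume u: "\<phi> r \<in> Units S"
    then have inv_K: "inv\<^bsub>S\<^esub> (\<phi> r) \<in> K"
      using r H_K by (auto simp: H_def)
    have "j (inv\<^bsub>S\<^esub> (\<phi> r)) \<otimes>\<^bsub>T\<^esub> j (\<phi> r) = \<one>\<^bsub>T\<^esub>" "j (\<phi> r) \<otimes>\<^bsub>T\<^esub> j (inv\<^bsub>S\<^esub> (\<phi> r)) = \<one>\<^bsub>T\<^esub>"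
      using u inv_K \<phi>_K[OF r] by (simp_all add: mult_T one_T)
    then show "\<psi> r \<in> Units T"
      using inv_K \<phi>_K[OF r] r by (auto simp: Units_def carr_T \<psi>_def)
  qed
  then have "\<psi> -` Units T \<inter> carrier R = ?V" by auto
  ultimately have "hom_pair R S \<phi> = hom_pair R T \<psi>"
    by (simp add: hom_pair_def)
  then show ?thesis
    using T \<psi> by (auto simp: Hom_pairs_def)
qed

end

theory Submission
  imports Defs
begin

text \<open>
  Let \<open>B n\<close> be the Boolean ring of subsets of \<open>{0, ..., n - 1}\<close>, that is, the \<open>n\<close>-th power of the
  field \<open>F\<close> with two elements.  Like the spectrum of a commutative ring, the maximal elements of
  \<open>Hom(B n)\<close> correspond to the \<open>n\<close> points.  The ring \<open>M\<close> of two by two matrices over \<open>F\<close> is simple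
  and each of its elements is a unit or annihilates a nonzero element, so \<open>Hom(M)\<close> has one element
  only.  Suppose that a functor takes these values, and look at the diagonal embedding of \<open>B 2\<close>
  into \<open>M\<close>.  Exchanging the two coordinates of \<open>B 2\<close> extends to an automorphism of \<open>M\<close>
  (conjugation by a permutation matrix), which can only act trivially on the single point of \<open>M\<close>.
  Hence the image of this point in the value at \<open>B 2\<close> is fixed under the exchange.

  This is a contradiction as soon as the exchange moves both points of the value at \<open>B 2\<close>.  For the
  spectrum this is clear, but here nothing is known about the action of the functor on morphisms.
  The missing information comes from \<open>B 3\<close>.  The rings \<open>B n\<close> turn the contravariant functor into a
  covariant functor on finite nonempty sets whose values on sets with one, two and three elements
  have one, two and three elements.  The lemma \<open>set_functor_separates_points\<close> shows by counting
  that the two maps from a singleton to a pair then single out two different points, and the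
  exchange permutes these two.

  As the objects of the category live on the type \<open>'u\<close>, the finite rings \<open>B n\<close> and \<open>M\<close> enter through
  isomorphic copies on that type.
\<close>

section \<open>Functors on the finite sets with one, two and three elements\<close>

text \<open>
  If both maps from a singleton to a pair gave the same element \<open>x\<close>, then every map that factors
  through a singleton would send everything to \<open>x\<close>.  Take the other element \<open>y\<close> over the pair and
  push it forward along the three two-element subsets of a triple.  The retraction of the triple
  onto a pair that collapses one of these subsets sends its copy of \<open>y\<close> to \<open>x\<close>, but the other two
  copies to \<open>y\<close>.  So the three copies of \<open>y\<close> and the image of \<open>x\<close> are four different elements over
  the triple.
\<close>

lemma set_functor_separates_points:
  fixes P :: "nat \<Rightarrow> 'a set" and act :: "nat \<Rightarrow> nat \<Rightarrow> (nat \<Rightarrow> nat) \<Rightarrow> 'a \<Rightarrow> 'a"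
  assumes closed: "\<And>m n f x. \<lbrakk>0 < m; f \<in> {..<m} \<rightarrow> {..<n}; x \<in> P m\<rbrakk> \<Longrightarrow> act m n f x \<in> P n"
    and ident: "\<And>n f x. \<lbrakk>0 < n; \<And>i. i < n \<Longrightarrow> f i = i; x \<in> P n\<rbrakk> \<Longrightarrow> act n n f x = x"
    and comp: "\<And>m n k f g h x. \<lbrakk>0 < m; f \<in> {..<m} \<rightarrow> {..<n}; g \<in> {..<n} \<rightarrow> {..<k};
        \<And>i. i < m \<Longrightarrow> h i = g (f i); x \<in> P m\<rbrakk> \<Longrightarrow> act m k h x = act n k g (act m n f x)"
    and P1: "P 1 = {p}" and P2: "card (P 2) = 2" and P3: "card (P 3) = 3"
  shows "act 1 2 (\<lambda>_. 0) p \<noteq> act 1 2 (\<lambda>_. 1) p"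
proof
  define x where "x = act 1 2 (\<lambda>_. 0) p"
  assume "act 1 2 (\<lambda>_. 0) p = act 1 2 (\<lambda>_. 1) p"
  then have x1: "act 1 2 (\<lambda>_. 1) p = x" by (simp add: x_def)
  have pt: "act 1 2 (\<lambda>_. i) p = x" if "i < 2" for i
    using that x1 x_def by (cases "i = 0") (auto simp: less_2_cases_iff)
  have xP: "x \<in> P 2" unfolding x_def using closed[of 1 "\<lambda>_. 0" 2 p] P1 by simp
  have "P 2 \<noteq> {x}" using P2 by auto
  then obtain y where y: "y \<in> P 2" "y \<noteq> x" using xP by blast
  have const: "act m 2 h z = x" if "0 < m" "z \<in> P m" "j < 2" "\<And>i. i < m \<Longrightarrow> h i = j" for m h z j
  proof -
    have "act m 2 h z = act 1 2 (\<lambda>_. j) (act m 1 (\<lambda>_. 0) z)"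
      using that by (intro comp) auto
    moreover have "act m 1 (\<lambda>_. 0) z = p"
      using closed[of m "\<lambda>_. 0" 1 z] that P1 by simp
    ultimately show ?thesis using pt that by simp
  qed
  \<comment> \<open>\<open>f a\<close> enumerates the subset that omits \<open>a\<close>, and \<open>r a\<close> collapses this subset to one point.\<close>
  define f where "f a i = (if i < a then i else Suc i)" for a i :: nat
  define r :: "nat \<Rightarrow> nat \<Rightarrow> nat" where "r a i = (if i = a then 0 else 1)" for a i
  have f: "f a \<in> {..<2} \<rightarrow> {..<3}" for a by (auto simp: f_def)
  have r: "r a \<in> {..<3} \<rightarrow> {..<2}" for a by (auto simp: r_def)
  define Y where "Y a = act 2 3 (f a) y" for a
  have YP: "Y a \<in> P 3" for a unfolding Y_def using closed[OF _ f] y by simp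
  have same: "act 3 2 (r a) (Y a) = x" for a
  proof -
    have "act 3 2 (r a) (Y a) = act 2 2 (r a \<circ> f a) y"
      unfolding Y_def using y by (intro comp[symmetric] f r) auto
    also have "\<dots> = x" by (rule const[where j = 1]) (use y in \<open>auto simp: r_def f_def\<close>)
    finally show ?thesis .
  qed
  \<comment> \<open>A bijection fixes \<open>x\<close> and acts as an involution, so it cannot move \<open>y\<close> to \<open>x\<close>.\<close>
  have bij: "act 2 2 h y \<noteq> x" if h: "h \<in> {..<2} \<rightarrow> {..<2}" "h 0 \<noteq> h 1" for h
  proof
    assume x: "act 2 2 h y = x"
    have hh: "h (h i) = i" if "i < 2" for i
    proof -
      have "h 0 < 2" "h 1 < 2" using h(1) by auto
      then show ?thesis using h(2) that by (auto simp: less_2_cases_iff)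
    qed
    have "y = act 2 2 id y" using y by (intro ident[symmetric]) auto
    also have "\<dots> = act 2 2 h (act 2 2 h y)" using h y hh by (intro comp) auto
    also have "\<dots> = act 1 2 (\<lambda>_. h 0) p"
      unfolding x x_def using h P1 by (intro comp[symmetric]) auto
    also have "\<dots> = x" using h(1) by (intro pt) auto
    finally show False using y by simp
  qed
  have diff: "act 3 2 (r a) (Y b) \<noteq> x" if "a < 3" "b < 3" "a \<noteq> b" for a b
  proof -
    have "act 3 2 (r a) (Y b) = act 2 2 (r a \<circ> f b) y"
      unfolding Y_def using y by (intro comp[symmetric] f r) auto
    also have "\<dots> \<noteq> x"
    proof (rule bij)
      show "r a \<circ> f b \<in> {..<2} \<rightarrow> {..<2}" by (auto simp: r_def)
      show "(r a \<circ> f b) 0 \<noteq> (r a \<circ> f b) 1" using that by (auto simp: r_def f_def)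
    qed
    finally show ?thesis .
  qed
  define w where "w = act 1 3 (\<lambda>_. 0) p"
  have wP: "w \<in> P 3" unfolding w_def using closed[of 1 "\<lambda>_. 0" 3 p] P1 by simp
  have rw: "act 3 2 (r a) w = x" for a
  proof -
    have "act 3 2 (r a) w = act 1 2 (\<lambda>_. r a 0) p"
      unfolding w_def using P1 r by (intro comp[symmetric]) auto
    then show ?thesis using pt by (simp add: r_def)
  qed
  have "Y 0 \<noteq> Y 1" "Y 0 \<noteq> Y 2" "Y 1 \<noteq> Y 2"
    using diff[of 0 1] diff[of 0 2] diff[of 1 2] same[of 0] same[of 1] by auto
  moreover have "w \<noteq> Y 0" "w \<noteq> Y 1" "w \<noteq> Y 2"
    using diff[of 1 0] diff[of 0 1] diff[of 0 2] rw[of 0] rw[of 1] by auto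
  ultimately have "card {w, Y 0, Y 1, Y 2} = 4" by simp
  moreover have "card {w, Y 0, Y 1, Y 2} \<le> card (P 3)"
    using P3 wP YP by (intro card_mono) (auto intro: card_ge_0_finite)
  ultimately show False using P3 by simp
qed

section \<open>Copies of finite rings inside the universe\<close>

text \<open>
  The embedding is chosen once for each ring, so that copies of composable homomorphisms compose.
\<close>

definition emb :: "'a ring \<Rightarrow> 'a \<Rightarrow> 'u" where
  "emb R = (SOME e. inj_on e (carrier R))"

definition copy_ring :: "'a ring \<Rightarrow> 'u ring" where
  "copy_ring R = image_ring (emb R) R"

definition copy_mor :: "'a ring \<Rightarrow> 'b ring \<Rightarrow> ('a \<Rightarrow> 'b) \<Rightarrow> 'u \<Rightarrow> 'u" where
  "copy_mor R S f =
     (\<lambda>u\<in>carrier (copy_ring R :: 'u ring). emb S (f (inv_into (carrier R) (emb R) u)))"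

lemma carrier_copy_ring: "carrier (copy_ring R) = emb R ` carrier R"
  by (simp add: copy_ring_def image_ring_carrier)

lemma inj_on_emb:
  assumes "infinite (UNIV :: 'u set)" "finite (carrier R)"
  shows "inj_on (emb R :: 'a \<Rightarrow> 'u) (carrier R)"
proof -
  obtain T :: "'u set" where "finite T" "card T = card (carrier R)"
    using infinite_arbitrarily_large[OF assms(1)] by blast
  then obtain e :: "'a \<Rightarrow> 'u" where "inj_on e (carrier R)"
    using assms(2) by (metis finite_same_card_bij bij_betw_def)
  then show ?thesis unfolding emb_def by (rule someI[where P = "\<lambda>e. inj_on e (carrier R)"])
qed

lemma emb_ring_iso:
  assumes "infinite (UNIV :: 'u set)" "finite (carrier R)"
  shows "(emb R :: 'a \<Rightarrow> 'u) \<in> ring_iso R (copy_ring R)"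
  unfolding copy_ring_def using inj_imp_image_ring_iso[OF inj_on_emb[OF assms]] .

lemma nonzero_copy_ring:
  assumes "infinite (UNIV :: 'u set)" "finite (carrier R)" "nonzero_ring R"
  shows "nonzero_ring (copy_ring R :: 'u ring)"
proof -
  interpret ring R using assms by (simp add: nonzero_ring_def)
  have inj: "inj_on (emb R :: 'a \<Rightarrow> 'u) (carrier R)" by (rule inj_on_emb[OF assms(1,2)])
  show ?thesis
    using inj_imp_image_ring_is_ring[OF inj] assms(3) inj_on_eq_iff[OF inj one_closed zero_closed]
    by (simp add: nonzero_ring_def copy_ring_def image_ring_one image_ring_zero)
qed

lemma copy_mor_emb:
  assumes "infinite (UNIV :: 'u set)" "finite (carrier R)" "x \<in> carrier R"
  shows "copy_mor R S f (emb R x :: 'u) = emb S (f x)"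
  using assms by (simp add: copy_mor_def carrier_copy_ring inv_into_f_f[OF inj_on_emb])

lemma restrict_ring_hom:
  assumes "ring R" and h: "h \<in> ring_hom R S"
  shows "restrict h (carrier R) \<in> ring_mor R S"
proof -
  interpret ring R by fact
  have "restrict h (carrier R) \<in> ring_hom R S"
    by (rule ring_hom_memI)
      (simp_all add: ring_hom_closed[OF h] ring_hom_mult[OF h] ring_hom_add[OF h] ring_hom_one[OF h])
  then show ?thesis by (simp add: ring_mor_def)
qed

lemma copy_mor_closed:
  assumes "infinite (UNIV :: 'u set)" "finite (carrier R)" "finite (carrier S)" "nonzero_ring R"
    and f: "f \<in> ring_hom R S"
  shows "(copy_mor R S f :: 'u \<Rightarrow> 'u) \<in> ring_mor (copy_ring R) (copy_ring S)"
proof -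
  let ?e = "emb R :: 'a \<Rightarrow> 'u" and ?e' = "emb S :: 'b \<Rightarrow> 'u"
  have "ring R" using assms(4) by (simp add: nonzero_ring_def)
  then have inv: "inv_into (carrier R) ?e \<in> ring_hom (copy_ring R) R"
    using ring_iso_set_sym[OF _ emb_ring_iso[OF assms(1,2)]] by (simp add: ring_iso_def)
  have e': "?e' \<in> ring_hom S (copy_ring S)"
    using emb_ring_iso[OF assms(1,3)] by (simp add: ring_iso_def)
  have h: "?e' \<circ> (f \<circ> inv_into (carrier R) ?e) \<in> ring_hom (copy_ring R) (copy_ring S)"
    by (rule ring_hom_trans[OF ring_hom_trans[OF inv f] e'])
  have "ring (copy_ring R :: 'u ring)"
    using nonzero_copy_ring[OF assms(1,2,4)] by (simp add: nonzero_ring_def)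
  from restrict_ring_hom[OF this h] show ?thesis
    by (simp add: copy_mor_def comp_def)
qed

text \<open>
  The functor is only evaluated at copies of finite rings.  In the next three lemmas the
  homomorphisms of the original rings are compared on carriers only, so that they need not be
  extensional.
\<close>

definition induced ::
  "('u ring \<Rightarrow> 'u ring \<Rightarrow> ('u \<Rightarrow> 'u) \<Rightarrow> 'x \<Rightarrow> 'x) \<Rightarrow> 'a ring \<Rightarrow> 'b ring \<Rightarrow> ('a \<Rightarrow> 'b) \<Rightarrow> 'x \<Rightarrow> 'x" where
  "induced Fm R S f = Fm (copy_ring R) (copy_ring S) (copy_mor R S f)"

lemma induced_closed:
  fixes Fo :: "'u ring \<Rightarrow> 'x set"
  assumes "infinite (UNIV :: 'u set)" "contravariant_functor Fo Fm"
    "finite (carrier R)" "finite (carrier S)" "nonzero_ring R" "nonzero_ring S" "f \<in> ring_hom R S"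
    and p: "p \<in> Fo (copy_ring S)"
  shows "induced Fm R S f p \<in> Fo (copy_ring R)"
proof -
  have "Fm (copy_ring R) (copy_ring S) (copy_mor R S f) \<in> Fo (copy_ring S) \<rightarrow>\<^sub>E Fo (copy_ring R)"
    using assms(2) nonzero_copy_ring[OF assms(1,3,5)] nonzero_copy_ring[OF assms(1,4,6)]
      copy_mor_closed[OF assms(1,3,4,5,7)]
    unfolding contravariant_functor_def by blast
  then show ?thesis using p by (auto simp: induced_def)
qed

lemma induced_ident:
  fixes Fo :: "'u ring \<Rightarrow> 'x set"
  assumes "infinite (UNIV :: 'u set)" "contravariant_functor Fo Fm"
    "finite (carrier R)" "nonzero_ring R" and f: "\<And>x. x \<in> carrier R \<Longrightarrow> f x = x"
    and p: "p \<in> Fo (copy_ring R)"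
  shows "induced Fm R R f p = p"
proof -
  have "copy_mor R R f = (\<lambda>u\<in>carrier (copy_ring R :: 'u ring). u)"
    unfolding copy_mor_def
    by (rule restrict_ext)
      (auto simp: carrier_copy_ring f inv_into_f_f[OF inj_on_emb[OF assms(1,3)]])
  then show ?thesis
    using assms(2) nonzero_copy_ring[OF assms(1,3,4)] p
    unfolding contravariant_functor_def induced_def by simp
qed

lemma induced_comp:
  fixes Fo :: "'u ring \<Rightarrow> 'x set"
  assumes "infinite (UNIV :: 'u set)" "contravariant_functor Fo Fm"
    and fin: "finite (carrier R)" "finite (carrier S)" "finite (carrier T)"
    and nz: "nonzero_ring R" "nonzero_ring S" "nonzero_ring T"
    and f: "f \<in> ring_hom R S" and g: "g \<in> ring_hom S T"
    and h: "\<And>x. x \<in> carrier R \<Longrightarrow> h x = g (f x)"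
    and p: "p \<in> Fo (copy_ring T)"
  shows "induced Fm R T h p = induced Fm R S f (induced Fm S T g p)"
proof -
  let ?R = "copy_ring R :: 'u ring" and ?S = "copy_ring S :: 'u ring" and ?T = "copy_ring T :: 'u ring"
  have "copy_mor R T h = compose (carrier ?R) (copy_mor S T g) (copy_mor R S f)"
  proof
    fix u
    show "copy_mor R T h u = compose (carrier ?R) (copy_mor S T g) (copy_mor R S f) u"
    proof (cases "u \<in> carrier ?R")
      case True
      then obtain x where x: "x \<in> carrier R" "u = emb R x" by (auto simp: carrier_copy_ring)
      moreover have "f x \<in> carrier S" using f x by (auto simp: ring_hom_def)
      ultimately show ?thesis
        using True by (simp add: compose_def copy_mor_emb assms(1) fin h)
    qed (simp add: compose_def copy_mor_def)
  qed
  then show ?thesis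
    using assms(2) nonzero_copy_ring[OF assms(1) fin(1) nz(1)]
      nonzero_copy_ring[OF assms(1) fin(2) nz(2)] nonzero_copy_ring[OF assms(1) fin(3) nz(3)]
      copy_mor_closed[OF assms(1) fin(1,2) nz(1) f] copy_mor_closed[OF assms(1) fin(2,3) nz(2) g] p
    unfolding contravariant_functor_def induced_def by (simp add: compose_def)
qed

definition copy_pair :: "'a ring \<Rightarrow> 'a set \<times> 'a set \<Rightarrow> 'u set \<times> 'u set" where
  "copy_pair R = map_prod ((`) (emb R)) ((`) (emb R))"

lemma hom_pair_copy_ring:
  assumes "infinite (UNIV :: 'u set)" "finite (carrier R)"
    and \<psi>: "\<And>x. x \<in> carrier R \<Longrightarrow> \<phi> (emb R x :: 'u) = \<psi> x"
  shows "hom_pair (copy_ring R) S \<phi> = copy_pair R (hom_pair R S \<psi>)"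
proof -
  have "{u \<in> emb R ` carrier R. Q (\<phi> u)} = emb R ` {x \<in> carrier R. Q (\<psi> x)}" for Q
    using \<psi> by auto
  from this[of "\<lambda>s. s = \<zero>\<^bsub>S\<^esub>"] this[of "\<lambda>s. s \<in> Units S"] show ?thesis
    by (simp add: hom_pair_def copy_pair_def a_kernel_def' carrier_copy_ring vimage_def
        Int_def conj_commute)
qed

text \<open>
  Pairs of the copy are the images of the pairs of the original ring.  To produce them, any codomain
  will do; conversely, a pair of the copy comes with a codomain on the type \<open>'u\<close>.
\<close>

lemma copy_pair_in_Hom_pairs:
  fixes S :: "('v, 'm) ring_scheme"
  assumes "infinite (UNIV :: 'u set)" "finite (carrier R)" "nonzero_ring R" "nonzero_ring S"
    and \<psi>: "\<psi> \<in> ring_hom R S"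
  shows "copy_pair R (hom_pair R S \<psi>) \<in> Hom_pairs (copy_ring R :: 'u ring)"
proof -
  let ?e = "emb R :: 'a \<Rightarrow> 'u" and ?R = "copy_ring R :: 'u ring"
  have "ring R" using assms(3) by (simp add: nonzero_ring_def)
  then have "inv_into (carrier R) ?e \<in> ring_hom ?R R"
    using ring_iso_set_sym[OF _ emb_ring_iso[OF assms(1,2)]] by (simp add: ring_iso_def)
  then have "\<psi> \<circ> inv_into (carrier R) ?e \<in> ring_hom ?R S"
    using ring_hom_trans[OF _ \<psi>] by blast
  then have "hom_pair ?R S (\<psi> \<circ> inv_into (carrier R) ?e) \<in> Hom_pairs ?R"
    by (intro Hom_pairs_arbitrary_codomain assms nonzero_copy_ring)
  then show ?thesis
    using hom_pair_copy_ring[OF assms(1,2), of "\<psi> \<circ> inv_into (carrier R) ?e" \<psi> S]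
    by (simp add: inv_into_f_f[OF inj_on_emb[OF assms(1,2)]])
qed

lemma Hom_pairs_copy_ringE:
  assumes "infinite (UNIV :: 'u set)" "finite (carrier R)"
    and p: "p \<in> Hom_pairs (copy_ring R :: 'u ring)"
  obtains S :: "'u ring" and \<psi> where "nonzero_ring S" "\<psi> \<in> ring_hom R S"
    "p = copy_pair R (hom_pair R S \<psi>)"
proof -
  obtain S :: "'u ring" and \<phi> where S: "nonzero_ring S" and \<phi>: "\<phi> \<in> ring_hom (copy_ring R) S"
    and p': "p = hom_pair (copy_ring R) S \<phi>"
    using p by (auto simp: Hom_pairs_def ring_mor_def)
  have "\<phi> \<circ> emb R \<in> ring_hom R S"
    using emb_ring_iso[OF assms(1,2)] by (intro ring_hom_trans[OF _ \<phi>]) (simp add: ring_iso_def)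
  moreover have "p = copy_pair R (hom_pair R S (\<phi> \<circ> emb R))"
    unfolding p' by (rule hom_pair_copy_ring[OF assms(1,2)]) simp
  ultimately show ?thesis using S that by blast
qed

section \<open>The Boolean ring of subsets of a finite set\<close>

definition subset_ring :: "nat \<Rightarrow> nat set ring" where
  "subset_ring n = \<lparr>carrier = Pow {..<n}, monoid.mult = (\<inter>), one = {..<n}, ring.zero = {},
     ring.add = (\<lambda>A B. (A - B) \<union> (B - A))\<rparr>"

lemma carrier_subset_ring: "carrier (subset_ring n) = Pow {..<n}"
  by (simp add: subset_ring_def)

text \<open>
  The preimage under a map \<open>f\<close> from \<open>{..<m}\<close> to \<open>{..<n}\<close>.  Through it, a contravariant functor on
  rings becomes a covariant one on finite sets.
\<close>

definition pull :: "nat \<Rightarrow> (nat \<Rightarrow> nat) \<Rightarrow> nat set \<Rightarrow> nat set" where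
  "pull m f A = {i. i < m \<and> f i \<in> A}"

lemma nonzero_subset_ring:
  assumes "0 < n"
  shows "nonzero_ring (subset_ring n)"
proof -
  have "ring (subset_ring n)"
  proof (intro ringI abelian_groupI monoidI)
    fix A assume "A \<in> carrier (subset_ring n)"
    then show "\<exists>B\<in>carrier (subset_ring n). B \<oplus>\<^bsub>subset_ring n\<^esub> A = \<zero>\<^bsub>subset_ring n\<^esub>"
      by (intro bexI[of _ A]) (auto simp: subset_ring_def)
  qed (auto simp: subset_ring_def)
  then show ?thesis using assms by (auto simp: nonzero_ring_def subset_ring_def)
qed

lemma finite_subset_ring: "finite (carrier (subset_ring n))"
  by (simp add: carrier_subset_ring)

lemma pull_ring_hom:
  assumes "f \<in> {..<m} \<rightarrow> {..<n}"
  shows "pull m f \<in> ring_hom (subset_ring n) (subset_ring m)"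
  using assms by (auto simp: ring_hom_def subset_ring_def pull_def)

text \<open>The pair of the evaluation at the point \<open>i\<close>: a prime ideal and its complement.\<close>

definition point_pair :: "nat \<Rightarrow> nat \<Rightarrow> nat set set \<times> nat set set" where
  "point_pair n i = ({A. A \<subseteq> {..<n} \<and> i \<notin> A}, {A. A \<subseteq> {..<n} \<and> i \<in> A})"

lemma point_pair_hom_pair:
  assumes "i < n"
  shows "point_pair n i = hom_pair (subset_ring n) (subset_ring 1) (pull 1 (\<lambda>_. i))"
proof -
  have "Units (subset_ring 1) = {{..<1}}"
    by (auto simp: Units_def subset_ring_def)
  then have unit: "pull 1 (\<lambda>_. i) A \<in> Units (subset_ring 1) \<longleftrightarrow> i \<in> A" for A
    by (auto simp: pull_def)
  have ker: "pull 1 (\<lambda>_. i) A = \<zero>\<^bsub>subset_ring 1\<^esub> \<longleftrightarrow> i \<notin> A" for A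
    by (auto simp: pull_def subset_ring_def)
  show ?thesis
    unfolding carrier_subset_ring point_pair_def hom_pair_def a_kernel_def' vimage_def unit ker by auto
qed

text \<open>
  The singletons sum up to one, so some singleton \<open>{i}\<close> has nonzero image.  A subset in the kernel
  cannot contain \<open>i\<close>, since \<open>{i}\<close> would be a multiple of it; a subset whose image is a unit must
  contain \<open>i\<close>, since otherwise its product with \<open>{i}\<close> is zero.
\<close>

lemma hom_pair_subset_ring_le_point:
  assumes n: "0 < n" and S: "nonzero_ring S" and \<psi>: "\<psi> \<in> ring_hom (subset_ring n) S"
  obtains i where "i < n" "pair_le (hom_pair (subset_ring n) S \<psi>) (point_pair n i)"
proof -
  interpret S: ring S using S by (simp add: nonzero_ring_def)
  interpret R: ring "subset_ring n" using nonzero_subset_ring[OF n] by (simp add: nonzero_ring_def)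
  interpret h: ring_hom_ring "subset_ring n" S \<psi>
    by (rule ring_hom_ringI2[OF R.ring_axioms S.ring_axioms \<psi>])
  have inter: "\<psi> (A \<inter> B) = \<psi> A \<otimes>\<^bsub>S\<^esub> \<psi> B" if "A \<subseteq> {..<n}" "B \<subseteq> {..<n}" for A B
    using h.hom_mult[of A B] that by (simp add: subset_ring_def)
  have add: "\<psi> ((A - B) \<union> (B - A)) = \<psi> A \<oplus>\<^bsub>S\<^esub> \<psi> B" if "A \<subseteq> {..<n}" "B \<subseteq> {..<n}" for A B
    using h.hom_add[of A B] that by (simp add: subset_ring_def)
  have empty: "\<psi> {} = \<zero>\<^bsub>S\<^esub>" using h.hom_zero by (simp add: subset_ring_def)
  have closed: "\<psi> A \<in> carrier S" if "A \<subseteq> {..<n}" for A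
    using h.hom_closed[of A] that by (simp add: subset_ring_def)
  have "\<exists>i<n. \<psi> {i} \<noteq> \<zero>\<^bsub>S\<^esub>"
  proof (rule ccontr)
    assume "\<not> ?thesis"
    then have z: "\<psi> {i} = \<zero>\<^bsub>S\<^esub>" if "i < n" for i using that by blast
    have "\<psi> {..<k} = \<zero>\<^bsub>S\<^esub>" if "k \<le> n" for k
      using that
    proof (induction k)
      case 0
      then show ?case by (simp add: empty)
    next
      case (Suc k)
      have "{..<Suc k} = ({..<k} - {k}) \<union> ({k} - {..<k})" by auto
      also have "\<psi> \<dots> = \<psi> {..<k} \<oplus>\<^bsub>S\<^esub> \<psi> {k}" using Suc.prems by (intro add) auto
      finally show ?case using Suc z by simp
    qed
    then have "\<psi> {..<n} = \<zero>\<^bsub>S\<^esub>" by simp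
    moreover have "\<psi> {..<n} = \<one>\<^bsub>S\<^esub>" using h.hom_one by (simp add: subset_ring_def)
    ultimately show False using S by (simp add: nonzero_ring_def)
  qed
  then obtain i where i: "i < n" "\<psi> {i} \<noteq> \<zero>\<^bsub>S\<^esub>" by blast
  have ker: "i \<notin> A" if A: "A \<subseteq> {..<n}" "\<psi> A = \<zero>\<^bsub>S\<^esub>" for A
  proof
    assume "i \<in> A"
    then have "\<psi> {i} = \<psi> (A \<inter> {i})" by (simp add: Int_absorb1)
    also have "\<dots> = \<zero>\<^bsub>S\<^esub>" using A i closed[of "{i}"] by (subst inter) auto
    finally show False using i by simp
  qed
  have unit: "i \<in> A" if A: "A \<subseteq> {..<n}" "\<psi> A \<in> Units S" for A
  proof (rule ccontr)
    assume "i \<notin> A"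
    then have "A \<inter> {i} = {}" by auto
    then have "\<psi> A \<otimes>\<^bsub>S\<^esub> \<psi> {i} = \<zero>\<^bsub>S\<^esub>"
      using inter[of A "{i}"] A i empty by simp
    then have "inv\<^bsub>S\<^esub> (\<psi> A) \<otimes>\<^bsub>S\<^esub> (\<psi> A \<otimes>\<^bsub>S\<^esub> \<psi> {i}) = \<zero>\<^bsub>S\<^esub>" using A by simp
    then have "\<psi> {i} = \<zero>\<^bsub>S\<^esub>" using A i closed[of "{i}"] closed[of A]
      by (simp add: S.m_assoc[symmetric])
    then show False using i by simp
  qed
  have "pair_le (hom_pair (subset_ring n) S \<psi>) (point_pair n i)"
    unfolding carrier_subset_ring pair_le_def hom_pair_def point_pair_def a_kernel_def' vimage_def
      fst_conv snd_conv
    using ker unit by blast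
  then show ?thesis using that i by blast
qed

lemma point_pair_le_iff:
  assumes "i < n" "pair_le (point_pair n i) (point_pair n j)"
  shows "i = j"
proof -
  have "{i} \<in> snd (point_pair n i)" using assms by (auto simp: point_pair_def)
  then have "{i} \<in> snd (point_pair n j)" using assms(2) by (auto simp: pair_le_def)
  then show ?thesis by (simp add: point_pair_def)
qed

lemma pair_le_antisym: "pair_le p q \<Longrightarrow> pair_le q p \<Longrightarrow> p = q"
  by (auto simp: pair_le_def prod_eq_iff)

lemma copy_pair_mono: "pair_le p q \<Longrightarrow> pair_le (copy_pair R p) (copy_pair R q)"
  by (auto simp: pair_le_def copy_pair_def)

lemma copy_pair_le_iff:
  assumes "infinite (UNIV :: 'u set)" "finite (carrier R)"
    and "fst p \<union> snd p \<subseteq> carrier R" "fst q \<union> snd q \<subseteq> carrier R"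
  shows "pair_le (copy_pair R p :: 'u set \<times> 'u set) (copy_pair R q) \<longleftrightarrow> pair_le p q"
proof -
  have "(emb R ` A :: 'u set) \<subseteq> emb R ` B \<longleftrightarrow> A \<subseteq> B"
    if "A \<subseteq> carrier R" "B \<subseteq> carrier R" for A B
    using that inj_on_image_mem_iff[OF inj_on_emb[OF assms(1,2)], of _ B] by blast
  then show ?thesis using assms(3,4) by (simp add: pair_le_def copy_pair_def)
qed

lemma card_Max_Hom_subset_ring:
  assumes inf: "infinite (UNIV :: 'u set)" and n: "0 < n"
  shows "card (Max_Hom (copy_ring (subset_ring n) :: 'u ring)) = n"
proof -
  let ?R = "copy_ring (subset_ring n) :: 'u ring"
  let ?p = "\<lambda>i. copy_pair (subset_ring n) (point_pair n i) :: 'u set \<times> 'u set"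
  have point: "?p i \<in> Hom_pairs ?R" if "i < n" for i
    unfolding point_pair_hom_pair[OF that]
    using that n
    by (intro copy_pair_in_Hom_pairs inf finite_subset_ring nonzero_subset_ring pull_ring_hom) auto
  have above: "\<exists>i<n. pair_le q (?p i)" if Q: "q \<in> Hom_pairs ?R" for q
  proof -
    obtain S :: "'u ring" and \<psi> where S: "nonzero_ring S" "\<psi> \<in> ring_hom (subset_ring n) S"
      and q: "q = copy_pair (subset_ring n) (hom_pair (subset_ring n) S \<psi>)"
      using Hom_pairs_copy_ringE[OF inf finite_subset_ring Q] by blast
    obtain i where "i < n" "pair_le (hom_pair (subset_ring n) S \<psi>) (point_pair n i)"
      using hom_pair_subset_ring_le_point[OF n S] .
    then show ?thesis using q copy_pair_mono by blast
  qed
  have eq: "i = j" if "i < n" "pair_le (?p i) (?p j)" for i j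
  proof (rule point_pair_le_iff[OF that(1)])
    show "pair_le (point_pair n i) (point_pair n j)"
      using that(2)
      by (subst (asm) copy_pair_le_iff[OF inf finite_subset_ring])
        (auto simp: point_pair_def subset_ring_def)
  qed
  have "Max_Hom ?R = ?p ` {..<n}"
  proof
    show "Max_Hom ?R \<subseteq> ?p ` {..<n}"
    proof
      fix q assume q: "q \<in> Max_Hom ?R"
      then obtain i where "i < n" "pair_le q (?p i)" using above[of q] by (auto simp: Max_Hom_def)
      then have "?p i = q" using q point by (simp add: Max_Hom_def)
      then show "q \<in> ?p ` {..<n}" using \<open>i < n\<close> by blast
    qed
    show "?p ` {..<n} \<subseteq> Max_Hom ?R"
    proof
      fix p assume "p \<in> ?p ` {..<n}"
      then obtain i where i: "i < n" "p = ?p i" by auto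
      have "q = p" if q: "q \<in> Hom_pairs ?R" "pair_le p q" for q
      proof -
        obtain j where j: "j < n" "pair_le q (?p j)" using above q by blast
        have "pair_le (?p i) (?p j)" using q j i by (auto simp: pair_le_def)
        then have "i = j" using eq i by blast
        then show ?thesis using q j i pair_le_antisym by blast
      qed
      then show "p \<in> Max_Hom ?R" using point i by (auto simp: Max_Hom_def)
    qed
  qed
  moreover have "inj_on ?p {..<n}"
  proof (rule inj_onI)
    fix i j assume "i \<in> {..<n}" "?p i = ?p j"
    then show "i = j" using eq[of i j] by (simp add: pair_le_def)
  qed
  ultimately show ?thesis by (simp add: card_image)
qed

section \<open>Two by two matrices over the field with two elements\<close>

text \<open>Indices and entries are Booleans; inequality of Booleans is addition modulo two.\<close>

definition mat_ring :: "(bool \<Rightarrow> bool \<Rightarrow> bool) ring" where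
  "mat_ring = \<lparr>carrier = UNIV,
     monoid.mult = (\<lambda>a b i k. (a i False \<and> b False k) \<noteq> (a i True \<and> b True k)),
     one = (\<lambda>i k. i = k), ring.zero = (\<lambda>i k. False), ring.add = (\<lambda>a b i k. a i k \<noteq> b i k)\<rparr>"

lemma finite_mat_ring: "finite (carrier mat_ring)"
  by (simp add: mat_ring_def)

lemma nonzero_mat_ring: "nonzero_ring mat_ring"
proof -
  have "ring mat_ring"
  proof (intro ringI abelian_groupI monoidI)
    fix a assume "a \<in> carrier mat_ring"
    show "\<exists>b\<in>carrier mat_ring. b \<oplus>\<^bsub>mat_ring\<^esub> a = \<zero>\<^bsub>mat_ring\<^esub>"
      by (intro bexI[of _ a]) (auto simp: mat_ring_def)
  qed (auto simp: mat_ring_def fun_eq_iff all_bool_eq)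
  then show ?thesis by (auto simp: nonzero_ring_def mat_ring_def fun_eq_iff)
qed

text \<open>
  The kernel is trivial because the ring is simple: from an entry one of a matrix \<open>a\<close>, multiplication
  by matrix units on both sides recovers the identity.  An element with invertible image is
  a unit: otherwise its determinant vanishes, so that it annihilates its adjugate.  Then the
  adjugate lies in the kernel and is zero, and so is the element itself.
\<close>

lemma hom_pair_mat_ring:
  assumes S: "nonzero_ring S" and \<psi>: "\<psi> \<in> ring_hom mat_ring S"
  shows "hom_pair mat_ring S \<psi> = ({\<zero>\<^bsub>mat_ring\<^esub>}, Units mat_ring)"
proof -
  interpret S: ring S using S by (simp add: nonzero_ring_def)
  interpret R: ring mat_ring using nonzero_mat_ring by (simp add: nonzero_ring_def)
  interpret h: ring_hom_ring mat_ring S \<psi>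
    by (rule ring_hom_ringI2[OF R.ring_axioms S.ring_axioms \<psi>])
  have carr [simp]: "a \<in> carrier mat_ring" for a by (simp add: mat_ring_def)
  have S_one: "\<one>\<^bsub>S\<^esub> \<noteq> \<zero>\<^bsub>S\<^esub>" using S by (simp add: nonzero_ring_def)
  have ker: "a = \<zero>\<^bsub>mat_ring\<^esub>" if a: "\<psi> a = \<zero>\<^bsub>S\<^esub>" for a
  proof (rule ccontr)
    assume "a \<noteq> \<zero>\<^bsub>mat_ring\<^esub>"
    then obtain r s where rs: "a r s" by (auto simp: mat_ring_def fun_eq_iff)
    define e :: "bool \<Rightarrow> bool \<Rightarrow> bool \<Rightarrow> bool \<Rightarrow> bool" where "e i k = (\<lambda>i' k'. i' = i \<and> k' = k)" for i k
    have "\<one>\<^bsub>mat_ring\<^esub> = (e False r \<otimes>\<^bsub>mat_ring\<^esub> a \<otimes>\<^bsub>mat_ring\<^esub> e s False)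
        \<oplus>\<^bsub>mat_ring\<^esub> (e True r \<otimes>\<^bsub>mat_ring\<^esub> a \<otimes>\<^bsub>mat_ring\<^esub> e s True)"
      using rs by (cases r; cases s) (auto simp: mat_ring_def e_def fun_eq_iff all_bool_eq)
    then have "\<psi> \<one>\<^bsub>mat_ring\<^esub> = \<zero>\<^bsub>S\<^esub>" using a by simp
    then show False using S_one by simp
  qed
  have unit: "a \<in> Units mat_ring" if a: "\<psi> a \<in> Units S" for a
  proof -
    \<comment> \<open>The adjugate: signs do not matter in characteristic two.\<close>
    define adj where "adj = (\<lambda>i k. a (\<not> k) (\<not> i))"
    show ?thesis
    proof (cases "(a False False \<and> a True True) = (a False True \<and> a True False)")
      case True
      then have "a \<otimes>\<^bsub>mat_ring\<^esub> adj = \<zero>\<^bsub>mat_ring\<^esub>"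
        by (auto simp: mat_ring_def adj_def fun_eq_iff all_bool_eq)
      then have "\<psi> a \<otimes>\<^bsub>S\<^esub> \<psi> adj = \<zero>\<^bsub>S\<^esub>" by (metis carr h.hom_mult h.hom_zero)
      then have "inv\<^bsub>S\<^esub> (\<psi> a) \<otimes>\<^bsub>S\<^esub> (\<psi> a \<otimes>\<^bsub>S\<^esub> \<psi> adj) = \<zero>\<^bsub>S\<^esub>" using a by simp
      then have "\<psi> adj = \<zero>\<^bsub>S\<^esub>" using a by (simp add: S.m_assoc[symmetric])
      then have "adj = \<zero>\<^bsub>mat_ring\<^esub>" by (rule ker)
      then have "a = \<zero>\<^bsub>mat_ring\<^esub>" by (auto simp: adj_def mat_ring_def fun_eq_iff all_bool_eq)
      then have "\<zero>\<^bsub>S\<^esub> \<in> Units S" using a by simp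
      then show ?thesis using S_one by (metis S.Units_l_inv S.Units_inv_closed S.r_null)
    next
      case False
      then have "a \<otimes>\<^bsub>mat_ring\<^esub> adj = \<one>\<^bsub>mat_ring\<^esub>" "adj \<otimes>\<^bsub>mat_ring\<^esub> a = \<one>\<^bsub>mat_ring\<^esub>"
        by (auto simp: mat_ring_def adj_def fun_eq_iff all_bool_eq)
      then show ?thesis by (auto simp: Units_def)
    qed
  qed
  have unit': "\<psi> a \<in> Units S" if "a \<in> Units mat_ring" for a
  proof -
    obtain b where "a \<otimes>\<^bsub>mat_ring\<^esub> b = \<one>\<^bsub>mat_ring\<^esub>" "b \<otimes>\<^bsub>mat_ring\<^esub> a = \<one>\<^bsub>mat_ring\<^esub>"
      using \<open>a \<in> Units mat_ring\<close> by (auto simp: Units_def)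
    then have "\<psi> a \<otimes>\<^bsub>S\<^esub> \<psi> b = \<one>\<^bsub>S\<^esub>" "\<psi> b \<otimes>\<^bsub>S\<^esub> \<psi> a = \<one>\<^bsub>S\<^esub>"
      by (metis carr h.hom_mult h.hom_one)+
    then show ?thesis by (auto simp: Units_def)
  qed
  have "\<psi> a = \<zero>\<^bsub>S\<^esub> \<longleftrightarrow> a = \<zero>\<^bsub>mat_ring\<^esub>" "\<psi> a \<in> Units S \<longleftrightarrow> a \<in> Units mat_ring" for a
    using ker unit unit' h.hom_zero by blast+
  then show ?thesis unfolding hom_pair_def a_kernel_def' vimage_def by (auto simp: Units_def)
qed

lemma Max_Hom_mat_ring:
  assumes inf: "infinite (UNIV :: 'u set)"
  obtains t where "Max_Hom (copy_ring mat_ring :: 'u ring) = {t}"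
proof -
  let ?R = "copy_ring mat_ring :: 'u ring"
  let ?t = "copy_pair mat_ring ({\<zero>\<^bsub>mat_ring\<^esub>}, Units mat_ring) :: 'u set \<times> 'u set"
  have "id \<in> ring_hom mat_ring mat_ring" by (auto simp: ring_hom_def)
  then have "?t \<in> Hom_pairs ?R"
    using copy_pair_in_Hom_pairs[OF inf finite_mat_ring nonzero_mat_ring nonzero_mat_ring]
      hom_pair_mat_ring[OF nonzero_mat_ring] by metis
  moreover have "q = ?t" if Q: "q \<in> Hom_pairs ?R" for q
  proof -
    obtain S :: "'u ring" and \<psi> where S: "nonzero_ring S" "\<psi> \<in> ring_hom mat_ring S"
      and q: "q = copy_pair mat_ring (hom_pair mat_ring S \<psi>)"
      using Hom_pairs_copy_ringE[OF inf finite_mat_ring Q] by blast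
    then show ?thesis using hom_pair_mat_ring[OF S] by simp
  qed
  ultimately have "Max_Hom ?R = {?t}" unfolding Max_Hom_def by blast
  then show ?thesis by (rule that)
qed

definition diag :: "nat set \<Rightarrow> bool \<Rightarrow> bool \<Rightarrow> bool" where
  "diag A i k \<longleftrightarrow> i = k \<and> of_bool i \<in> A"

text \<open>Conjugation by the permutation matrix that exchanges the two coordinates.\<close>

definition flip :: "(bool \<Rightarrow> bool \<Rightarrow> bool) \<Rightarrow> bool \<Rightarrow> bool \<Rightarrow> bool" where
  "flip a i k = a (\<not> i) (\<not> k)"

lemma diag_ring_hom: "diag \<in> ring_hom (subset_ring 2) mat_ring"
  by (auto simp: ring_hom_def subset_ring_def mat_ring_def diag_def fun_eq_iff all_bool_eq)

lemma flip_ring_hom: "flip \<in> ring_hom mat_ring mat_ring"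
  by (auto simp: ring_hom_def mat_ring_def flip_def fun_eq_iff all_bool_eq)

lemma diag_pull_swap: "diag (pull 2 (\<lambda>i. 1 - i) A) = flip (diag A)"
  by (auto simp: diag_def flip_def pull_def fun_eq_iff all_bool_eq)

section \<open>No functor has the sets of maximal elements as values\<close>

theorem theorem5p7:
  assumes "infinite (UNIV :: 'u set)"
  shows "\<not> (\<exists>(Fo :: 'u ring \<Rightarrow> ('u set \<times> 'u set) set)
              (Fm :: 'u ring \<Rightarrow> 'u ring \<Rightarrow> ('u \<Rightarrow> 'u) \<Rightarrow> ('u set \<times> 'u set) \<Rightarrow> ('u set \<times> 'u set)).
            contravariant_functor Fo Fm \<and>
            (\<forall>R. nonzero_ring R \<longrightarrow> Fo R = Max_Hom R))"
proof clarify
  fix Fo :: "'u ring \<Rightarrow> ('u set \<times> 'u set) set"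
    and Fm :: "'u ring \<Rightarrow> 'u ring \<Rightarrow> ('u \<Rightarrow> 'u) \<Rightarrow> ('u set \<times> 'u set) \<Rightarrow> ('u set \<times> 'u set)"
  assume F: "contravariant_functor Fo Fm" and Max: "\<forall>R. nonzero_ring R \<longrightarrow> Fo R = Max_Hom R"
  note hyps = assms F
  define P where "P n = Fo (copy_ring (subset_ring n))" for n
  define act where "act m n f = induced Fm (subset_ring n) (subset_ring m) (pull m f)" for m n f
  have card_P: "card (P n) = n" if "0 < n" for n
    using card_Max_Hom_subset_ring[OF assms that] Max
      nonzero_copy_ring[OF assms finite_subset_ring nonzero_subset_ring[OF that]]
    by (simp add: P_def)
  have closed: "act m n f x \<in> P n" if "0 < m" "f \<in> {..<m} \<rightarrow> {..<n}" "x \<in> P m" for m n f x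
  proof -
    have "0 < n" using that(1,2) by fastforce
    then show ?thesis
      unfolding P_def act_def
      by (rule induced_closed[OF hyps finite_subset_ring finite_subset_ring
            nonzero_subset_ring nonzero_subset_ring pull_ring_hom])
        (use that in \<open>simp_all add: P_def\<close>)
  qed
  have ident: "act n n f x = x" if "0 < n" "\<And>i. i < n \<Longrightarrow> f i = i" "x \<in> P n" for n f x
    unfolding act_def
    by (rule induced_ident[OF hyps finite_subset_ring nonzero_subset_ring])
      (use that in \<open>auto simp: P_def pull_def subset_ring_def\<close>)
  have comp: "act m k h x = act n k g (act m n f x)"
    if "0 < m" "f \<in> {..<m} \<rightarrow> {..<n}" "g \<in> {..<n} \<rightarrow> {..<k}" "\<And>i. i < m \<Longrightarrow> h i = g (f i)" "x \<in> P m"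
    for m n k f g h x
  proof -
    have "0 < n" using that(1,2) by fastforce
    moreover from this have "0 < k" using that(3) by fastforce
    ultimately show ?thesis
      unfolding act_def
      by (intro induced_comp[OF hyps finite_subset_ring finite_subset_ring finite_subset_ring
            nonzero_subset_ring nonzero_subset_ring nonzero_subset_ring
            pull_ring_hom pull_ring_hom])
        (use that in \<open>auto simp: P_def pull_def\<close>)
  qed
  obtain p where P1: "P 1 = {p}" using card_P[of 1] by (auto simp: card_1_singleton_iff)
  let ?x = "\<lambda>j. act 1 2 (\<lambda>_. j) p"
  have neq: "?x 0 \<noteq> ?x 1"
    by (rule set_functor_separates_points[where P = P, OF closed ident comp P1])
      (simp_all add: card_P)
  have xP: "?x 0 \<in> P 2" "?x 1 \<in> P 2" using P1 by (intro closed; simp)+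
  have P2: "P 2 = {?x 0, ?x 1}"
  proof (rule card_subset_eq[symmetric])
    show "finite (P 2)" using card_P[of 2] by (auto intro: card_ge_0_finite)
    show "card {?x 0, ?x 1} = card (P 2)" using neq card_P[of 2] by simp
  qed (use xP in auto)
  \<comment> \<open>The two points over the pair are different, so the exchange moves every element of \<open>P 2\<close>.\<close>
  let ?swap = "\<lambda>i. 1 - i :: nat"
  have swap: "?swap \<in> {..<2} \<rightarrow> {..<2}" by auto
  have swap_x: "act 2 2 ?swap (?x 0) = ?x 1" "act 2 2 ?swap (?x 1) = ?x 0"
    by (rule comp[symmetric]; use P1 swap in \<open>simp del: One_nat_def\<close>)+
  obtain t where t: "Max_Hom (copy_ring mat_ring :: 'u ring) = {t}"
    using Max_Hom_mat_ring[OF assms] .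
  then have FoM: "Fo (copy_ring mat_ring) = {t}"
    using Max nonzero_copy_ring[OF assms finite_mat_ring nonzero_mat_ring] by simp
  have "0 < (2 :: nat)" by simp
  note nz2 = nonzero_subset_ring[OF this]
  note fin = finite_subset_ring finite_mat_ring
  \<comment> \<open>The restriction of the single point of the matrix ring to the diagonal matrices.\<close>
  define z where "z = induced Fm (subset_ring 2) mat_ring diag t"
  have zP: "z \<in> P 2"
    unfolding z_def P_def
    by (rule induced_closed[OF hyps fin nz2 nonzero_mat_ring diag_ring_hom]) (simp add: FoM)
  have flip_t: "induced Fm mat_ring mat_ring flip t = t"
    using induced_closed[OF hyps finite_mat_ring finite_mat_ring nonzero_mat_ring
        nonzero_mat_ring flip_ring_hom, of t] FoM by simp
  have "act 2 2 ?swap z = induced Fm (subset_ring 2) mat_ring (\<lambda>A. flip (diag A)) t"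
    unfolding z_def act_def
    by (rule induced_comp[symmetric, OF hyps _ _ _ nz2 nz2 nonzero_mat_ring
          pull_ring_hom[OF swap] diag_ring_hom])
      (simp_all only: fin diag_pull_swap FoM singletonI)
  also have "\<dots> = induced Fm (subset_ring 2) mat_ring diag (induced Fm mat_ring mat_ring flip t)"
    by (rule induced_comp[OF hyps _ _ _ nz2 nonzero_mat_ring nonzero_mat_ring
          diag_ring_hom flip_ring_hom]) (simp_all add: fin FoM)
  also have "\<dots> = z" by (simp add: flip_t z_def)
  finally have "act 2 2 ?swap z = z" .
  then show False using zP P2 swap_x neq by auto
qed

end
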